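(* Let $K\subset\mathbb{C}\cong\mathbb{R}^2$ be a (planar) convex body with boundary curve $\gamma:=\partial K$, let $\tau>0$ and $\varphi\in(0,\pi)$. Let $\mathbf{n}$ be the (multivalued) function of outer unit normals of $\gamma$ and assume that $\Omega(\mathbf{n},\tau)\ge\varphi$. Take $k:=\lceil\frac{\pi}{2\varphi}\rceil$. If $\mathbf{x}\in\partial K=\gamma$ and $\mathbf{n}_0=(\sin\alpha,-\cos\alpha)\in\mathbf{n}(\mathbf{x})$ is an outer unit normal to $\gamma$ at $\mathbf{x}$, then $F(\mathbf{x},\alpha,\varphi,\tau)\supset K$.
   Context: A planar convex body is a compact convex subset of $\mathbb{R}^2$ with nonempty interior. For $\mathbf{x}\in\partial K$, $\mathbf{n}(\mathbf{x})\subset S^1$ is the nonempty set of all outer unit normal vectors of $K$ at $\mathbf{x}$. The minimal oscillation (with respect to chord length) is $$\Omega(\mathbf{n},\tau):=\inf\{\arccos\langle\mathbf{u},\mathbf{w}\rangle:\ \mathbf{x},\mathbf{y}\in\partial K,\ |\mathbf{x}-\mathbf{y}|\ge\tau,\ \mathbf{u}\in\mathbf{n}(\mathbf{x}),\ \mathbf{w}\in\mathbf{n}(\mathbf{y})\}$$ (with the usual convention $\inf\emptyset=+\infty$). Fattened $n$-gons. For $k\in\mathbb{N}$, $k\ge1$, put $\varphi^*:=\frac{\pi}{2k}$ and, for $m=1,\dots,4k$, $$A_m:=\Big(\sum_{j=1}^m\cos(j\varphi^* )+\sum_{\ell=0}^{\lfloor m/k\rfloor}\cos(\ell k\varphi^*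 ),\ \sum_{j=1}^m\sin(j\varphi^* )+\sum_{\ell=0}^{\lfloor m/k\rfloor}\sin(\ell k\varphi^* )\Big).$$ The standard fattened $n$-gon ($n=4k$) $F_k$ is the convex hull of $A_1,\dots,A_{4k}$ (here $A_{4k-1}=(-1,0)$, $A_{4k}=(1,0)$). For $\tau>0$, $\alpha\in\mathbb{R}$, $\mathbf{x}\in\mathbb{R}^2$, $\varphi\in(0,\pi)$, with $k:=\lceil\frac{\pi}{2\varphi}\rceil$, define $$F(\mathbf{x},\alpha,\varphi,\tau):=U_\alpha(\tau F_k)+\mathbf{x},$$ where $U_\alpha$ is the counterclockwise rotation of $\mathbb{R}^2$ about the origin by angle $\alpha$. *)

theory Defs
  imports "HOL-Analysis.Analysis"
begin

text \<open>The plane is the type \<open>complex\<close>, with its real inner product \<open>\<bullet>\<close>; multiplication by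
  \<open>cis \<alpha>\<close> is the counterclockwise rotation by \<open>\<alpha>\<close>.\<close>

definition convex_body :: "complex set \<Rightarrow> bool" where
  "convex_body K \<longleftrightarrow> compact K \<and> convex K \<and> interior K \<noteq> {}"

definition outer_normals :: "complex set \<Rightarrow> complex \<Rightarrow> complex set" where
  "outer_normals K x = {u. norm u = 1 \<and> (\<forall>y\<in>K. u \<bullet> (y - x) \<le> 0)}"

text \<open>The infimum is taken in \<open>ereal\<close>, so that it is \<open>\<infinity>\<close> for the empty set, i.e. when no two
  boundary points have distance at least \<open>\<tau>\<close>.\<close>

definition min_oscillation :: "complex set \<Rightarrow> real \<Rightarrow> ereal" where
  "min_oscillation K \<tau> = Inf {ereal (arccos (u \<bullet> w)) | u w x y.
     x \<in> frontier K \<and> y \<in> frontier K \<and> dist x y \<ge> \<tau> \<and>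
     u \<in> outer_normals K x \<and> w \<in> outer_normals K y}"

definition fat_angle :: "nat \<Rightarrow> real" where
  "fat_angle k = pi / (2 * real k)"

definition fat_vertex :: "nat \<Rightarrow> nat \<Rightarrow> complex" where
  "fat_vertex k m = Complex
     ((\<Sum>j=1..m. cos (real j * fat_angle k)) + (\<Sum>l=0..m div k. cos (real l * real k * fat_angle k)))
     ((\<Sum>j=1..m. sin (real j * fat_angle k)) + (\<Sum>l=0..m div k. sin (real l * real k * fat_angle k)))"

definition std_fat_ngon :: "nat \<Rightarrow> complex set" where
  "std_fat_ngon k = convex hull (fat_vertex k ` {1..4 * k})"

text \<open>For \<open>0 < \<phi> < \<pi>\<close> the number \<open>\<lceil>\<pi> / (2 \<phi>)\<rceil>\<close> is a positive integer, so \<open>nat\<close> loses nothing.\<close>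

definition fat_ngon :: "complex \<Rightarrow> real \<Rightarrow> real \<Rightarrow> real \<Rightarrow> complex set" where
  "fat_ngon x \<alpha> \<phi> \<tau> =
     (\<lambda>z. cis \<alpha> * (\<tau> *\<^sub>R z) + x) ` std_fat_ngon (nat \<lceil>pi / (2 * \<phi>)\<rceil>)"

end

theory Submission
  imports Defs
begin

text \<open>Fix a step \<open>\<delta>\<close> below the fattening angle and walk around \<open>K\<close> from \<open>x\<close>, in either orientation,
  through support points \<open>p j\<close> whose normals turn by \<open>\<delta>\<close> at each step. The oscillation hypothesis
  makes every chord shorter than \<open>\<tau>\<close>, and the normals at its endpoints confine its direction to
  a sector of angle \<open>\<delta>\<close>. Adding the best possible contributions of the chords and letting \<open>\<delta>\<close>
  tend to the fattening angle bounds the support function of \<open>K\<close> in each edge normal direction of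
  the polygon by that of the polygon, and the polygon is the intersection of these half-planes. The
  edges of double length absorb the chords whose sector straddles the direction that counts most.\<close>

section \<open>Unit vectors by angle\<close>

text \<open>This is \<open>cis \<theta>\<close> turned clockwise by a right angle: the outer normal
  of an edge traversed counterclockwise in direction \<open>cis \<theta>\<close>.\<close>

definition unit_normal :: "real \<Rightarrow> complex" where
  "unit_normal \<theta> = Complex (sin \<theta>) (- cos \<theta>)"

lemma norm_unit_normal [simp]: "norm (unit_normal \<theta>) = 1"
  by (simp add: unit_normal_def cmod_def)

lemma inner_unit_normal: "unit_normal a \<bullet> unit_normal b = cos (b - a)"
  by (simp add: unit_normal_def inner_complex_def cos_diff)

lemma inner_cis_unit_normal: "cis a \<bullet> unit_normal b = sin (b - a)"
  by (simp add: unit_normal_def inner_complex_def sin_diff)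

lemma unit_normal_add:
  "unit_normal (\<theta> + \<beta>) = cos \<beta> *\<^sub>R unit_normal \<theta> + sin \<beta> *\<^sub>R cis \<theta>"
  by (simp add: unit_normal_def complex_eq_iff sin_add cos_add algebra_simps)

lemma inner_rotate_unit_normal: "(cis a * z) \<bullet> unit_normal (b + a) = z \<bullet> unit_normal b"
proof -
  have "(cis a * z) \<bullet> unit_normal (b + a) =
      ((sin a)\<^sup>2 + (cos a)\<^sup>2) * (Re z * sin b - Im z * cos b)"
    unfolding unit_normal_def inner_complex_def power2_eq_square
    by (simp add: sin_add cos_add) algebra
  then show ?thesis
    by (simp add: unit_normal_def inner_complex_def)
qed

lemma unit_normal_minus: "unit_normal (- \<theta>) = - cnj (unit_normal \<theta>)"
  by (simp add: unit_normal_def complex_eq_iff)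

lemma inner_neg_cnj: "(- cnj a) \<bullet> (- cnj b) = a \<bullet> b"
  by (simp add: inner_complex_def)

lemma unit_vector_unit_normal:
  assumes "norm u = 1"
  obtains \<theta> where "0 \<le> \<theta>" "\<theta> < 2 * pi" "u = unit_normal \<theta>"
proof -
  have "(- Im u)\<^sup>2 + (Re u)\<^sup>2 = 1"
    using assms by (simp add: cmod_def)
  then obtain t where "0 \<le> t" "t < 2 * pi" "- Im u = cos t" "Re u = sin t"
    by (metis sincos_total_2pi)
  then show ?thesis
    using that[of t] by (simp add: unit_normal_def complex_eq_iff)
qed

subsection \<open>Chains of support points\<close>

lemma support_point_exists:
  assumes "compact K" "K \<noteq> {}"
  obtains p where "p \<in> frontier K" "unit_normal \<theta> \<in> outer_normals K p"
proof -
  let ?u = "unit_normal \<theta>"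
  have "continuous_on K (\<lambda>z. ?u \<bullet> z)"
    by (intro continuous_intros)
  from continuous_attains_sup[OF assms this]
  obtain p where p: "p \<in> K" "\<forall>y\<in>K. ?u \<bullet> y \<le> ?u \<bullet> p"
    by blast
  have "p \<notin> interior K"
  proof
    assume "p \<in> interior K"
    then obtain e where e: "e > 0" "cball p e \<subseteq> K"
      by (auto simp: mem_interior_cball)
    have "p + e *\<^sub>R ?u \<in> K"
      using e by (intro subsetD[OF e(2)]) (simp add: dist_norm)
    with p(2) have "?u \<bullet> (p + e *\<^sub>R ?u) \<le> ?u \<bullet> p"
      by blast
    with e(1) show False
      by (simp add: inner_add_right inner_unit_normal)
  qed
  with p(1) have "p \<in> frontier K"
    using closure_subset[of K] by (auto simp: frontier_def)
  moreover have "?u \<in> outer_normals K p"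
    using p(2) by (simp add: outer_normals_def inner_diff_right)
  ultimately show ?thesis
    using that by blast
qed

text \<open>The support set in direction \<open>unit_normal (\<theta> 0)\<close> may be a whole
  segment, so \<open>x\<close> is forced at index 0; elsewhere any support point will do.\<close>

lemma support_chain_exists:
  assumes "compact K" "x \<in> frontier K" "unit_normal (\<theta> 0) \<in> outer_normals K x"
  obtains p :: "nat \<Rightarrow> complex" where "p 0 = x"
    "\<And>j. p j \<in> frontier K" "\<And>j. unit_normal (\<theta> j) \<in> outer_normals K (p j)"
proof -
  have "K \<noteq> {}"
    using assms(2) by auto
  have "\<exists>q. q \<in> frontier K \<and> unit_normal (\<theta> j) \<in> outer_normals K q \<and> (j = 0 \<longrightarrow> q = x)" for j
    using assms(2,3) support_point_exists[OF assms(1) \<open>K \<noteq> {}\<close>, of "\<theta> j"]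
    by (cases "j = 0") blast+
  then show ?thesis
    using that by metis
qed

text \<open>Expand the target normal in the orthonormal frame \<open>unit_normal \<theta>\<close>,
  \<open>cis \<theta>\<close>: the first component contributes at most 0, the second at most
  \<open>\<tau> * sin \<beta>\<close> by Cauchy-Schwarz. The sign \<open>s\<close> is the
  orientation of the walk.\<close>

lemma chord_bound_start:
  assumes "\<bar>s\<bar> = 1" "0 \<le> \<beta>" "\<beta> \<le> pi / 2" "c \<bullet> unit_normal \<theta> \<le> 0" "norm c \<le> \<tau>"
  shows "c \<bullet> unit_normal (\<theta> + s * \<beta>) \<le> \<tau> * sin \<beta>"
proof -
  have s: "s = 1 \<or> s = -1"
    using assms(1) by linarith
  have "s * (c \<bullet> cis \<theta>) \<le> norm c"
    using s Cauchy_Schwarz_ineq2[of c "cis \<theta>"] by auto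
  then have "s * (c \<bullet> cis \<theta>) \<le> \<tau>"
    using assms(5) by linarith
  then have "sin \<beta> * (s * (c \<bullet> cis \<theta>)) \<le> sin \<beta> * \<tau>"
    using assms(2,3) by (intro mult_left_mono sin_ge_zero) auto
  moreover have "cos \<beta> * (c \<bullet> unit_normal \<theta>) \<le> 0"
    using assms(2,3,4) by (intro mult_nonneg_nonpos cos_ge_zero) auto
  moreover have "c \<bullet> unit_normal (\<theta> + s * \<beta>) =
      cos \<beta> * (c \<bullet> unit_normal \<theta>) + sin \<beta> * (s * (c \<bullet> cis \<theta>))"
    using s by (auto simp: unit_normal_add inner_add_right inner_diff_right
        unit_normal_add[of \<theta> "- \<beta>", simplified])
  ultimately show ?thesis
    by (simp add: mult.commute)
qed

text \<open>The reversed chord starts at the other endpoint and sees the opposite target normal at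
  angle \<open>pi - \<beta>\<close>, turning the other way.\<close>

lemma chord_bound_end:
  assumes "\<bar>s\<bar> = 1" "pi / 2 \<le> \<beta>" "\<beta> \<le> pi" "0 \<le> c \<bullet> unit_normal \<theta>" "norm c \<le> \<tau>"
  shows "c \<bullet> unit_normal (\<theta> + s * \<beta>) \<le> \<tau> * sin \<beta>"
proof -
  have s: "s = 1 \<or> s = -1"
    using assms(1) by linarith
  have n: "unit_normal (a + pi) = - unit_normal a" "unit_normal (a - pi) = - unit_normal a" for a
    by (simp_all add: unit_normal_def complex_eq_iff)
  have "(- c) \<bullet> unit_normal (\<theta> + (- s) * (pi - \<beta>)) \<le> \<tau> * sin (pi - \<beta>)"
    using assms by (intro chord_bound_start) auto
  moreover have "unit_normal (\<theta> + (- s) * (pi - \<beta>)) = - unit_normal (\<theta> + s * \<beta>)"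
    using s n[of "\<theta> + \<beta>"] n[of "\<theta> - \<beta>"] by (auto simp: algebra_simps)
  ultimately show ?thesis
    by simp
qed

text \<open>Bounds the contribution of the chord that has \<open>r\<close> further steps to go. The case distinction
  selects the better end of the sector of its possible directions; for \<open>r = k\<close> the best
  direction may lie inside the sector.\<close>

definition chord_weight :: "nat \<Rightarrow> real \<Rightarrow> nat \<Rightarrow> real" where
  "chord_weight k \<delta> r =
     (if r < k then sin (real (Suc r) * \<delta>) else if r = k then 1 else sin (real r * \<delta>))"

text \<open>Since \<open>p m\<close> is extremal in the final direction, it can replace
  \<open>P\<close>; then the path from \<open>x\<close> to \<open>p m\<close> telescopes into
  chords. The bounds on \<open>\<delta>\<close> put the right angle between \<open>k\<close> and
  \<open>Suc k\<close> steps, and \<open>m \<le> 2 * k\<close> keeps all angles within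
  \<open>pi\<close>.\<close>

lemma support_chain_bound:
  assumes "compact K" "x \<in> frontier K" "unit_normal \<alpha> \<in> outer_normals K x"
    and s: "\<bar>s\<bar> = 1" and \<delta>: "0 \<le> \<delta>" "real k * \<delta> \<le> pi / 2" "pi / 2 \<le> real (Suc k) * \<delta>"
    and m: "m \<le> 2 * k" and "0 \<le> \<tau>"
    and close: "\<And>p q \<theta>. p \<in> frontier K \<Longrightarrow> q \<in> frontier K \<Longrightarrow>
      unit_normal \<theta> \<in> outer_normals K p \<Longrightarrow> unit_normal (\<theta> + s * \<delta>) \<in> outer_normals K q \<Longrightarrow>
      dist p q \<le> \<tau>"
    and P: "P \<in> K"
  shows "(P - x) \<bullet> unit_normal (\<alpha> + s * (real m * \<delta>)) \<le> \<tau> * (\<Sum>r<m. chord_weight k \<delta> r)"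
proof -
  define \<theta> where "\<theta> j = \<alpha> + s * (real j * \<delta>)" for j :: nat
  have step: "\<theta> (Suc j) = \<theta> j + s * \<delta>" for j
    by (simp add: \<theta>_def algebra_simps)
  have \<theta>_le: "\<theta> m = \<theta> j + s * (real (m - j) * \<delta>)" if "j \<le> m" for j
    using that by (simp add: \<theta>_def of_nat_diff algebra_simps)
  obtain p where p: "p 0 = x" "\<And>j. p j \<in> frontier K"
      "\<And>j. unit_normal (\<theta> j) \<in> outer_normals K (p j)"
    using support_chain_exists[of K x \<theta>] assms(1-3) by (auto simp: \<theta>_def)
  have pK: "p j \<in> K" for j
    using p(2)[of j] compact_imp_closed[OF assms(1)] frontier_subset_closed by blast
  have chord: "(p (Suc j) - p j) \<bullet> unit_normal (\<theta> m) \<le> \<tau> * chord_weight k \<delta> (m - Suc j)"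
    if j: "j < m" for j
  proof -
    let ?c = "p (Suc j) - p j" and ?r = "m - Suc j"
    have c: "norm ?c \<le> \<tau>"
      using close[OF p(2) p(2) p(3)[of j], of "Suc j"] p(3)[of "Suc j"]
      by (simp add: step dist_norm norm_minus_commute)
    \<comment> \<open>Each endpoint is extremal for its own normal, which gives one sign condition
      at each end of the chord.\<close>
    have start: "?c \<bullet> unit_normal (\<theta> j) \<le> 0"
      using p(3)[of j] pK[of "Suc j"] by (simp add: outer_normals_def inner_commute)
    have "unit_normal (\<theta> (Suc j)) \<bullet> (p j - p (Suc j)) \<le> 0"
      using p(3)[of "Suc j"] pK[of j] by (simp add: outer_normals_def)
    then have "end": "0 \<le> ?c \<bullet> unit_normal (\<theta> (Suc j))"
      by (simp add: inner_diff inner_commute)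
    consider "?r < k" | "?r = k" | "?r > k"
      by linarith
    then show ?thesis
    proof cases
      case 1
      have "real (Suc ?r) * \<delta> \<le> real k * \<delta>"
        using 1 \<delta>(1) by (intro mult_right_mono) auto
      then show ?thesis
        using chord_bound_start[OF s _ _ start c, of "real (m - j) * \<delta>"] \<theta>_le[of j] j \<delta> 1
        by (simp add: chord_weight_def Suc_diff_Suc del: of_nat_Suc)
    next
      case 2
      have "?c \<bullet> unit_normal (\<theta> m) \<le> norm ?c"
        using norm_cauchy_schwarz[of ?c "unit_normal (\<theta> m)"] by simp
      with 2 c show ?thesis
        by (simp add: chord_weight_def)
    next
      case 3
      have "real (Suc k) * \<delta> \<le> real ?r * \<delta>"
        using 3 \<delta>(1) by (intro mult_right_mono) auto
      moreover have "real ?r * \<delta> \<le> real (2 * k) * \<delta>"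
        using m \<delta>(1) by (intro mult_right_mono) auto
      ultimately show ?thesis
        using chord_bound_end[OF s _ _ "end" c, of "real ?r * \<delta>"] \<theta>_le[of "Suc j"] j \<delta> 3
        by (simp add: chord_weight_def del: of_nat_Suc)
    qed
  qed
  have "unit_normal (\<theta> m) \<bullet> (P - p m) \<le> 0"
    using p(3)[of m] P by (simp add: outer_normals_def)
  then have "(P - x) \<bullet> unit_normal (\<theta> m) \<le> (p m - p 0) \<bullet> unit_normal (\<theta> m)"
    by (simp add: p(1) inner_diff inner_commute)
  also have "\<dots> = (\<Sum>j<m. (p (Suc j) - p j) \<bullet> unit_normal (\<theta> m))"
    by (simp add: sum_lessThan_telescope flip: inner_sum_left)
  also have "\<dots> \<le> (\<Sum>j<m. \<tau> * chord_weight k \<delta> (m - Suc j))"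
    using chord by (intro sum_mono) auto
  also have "\<dots> = \<tau> * (\<Sum>r<m. chord_weight k \<delta> r)"
    by (simp add: sum.nat_diff_reindex flip: sum_distrib_left)
  finally show ?thesis
    by (simp add: \<theta>_def)
qed

section \<open>Short chords and the limit of the step\<close>

lemma fat_angle_pos: "k \<ge> 1 \<Longrightarrow> 0 < fat_angle k"
  and mult_fat_angle: "k \<ge> 1 \<Longrightarrow> real k * fat_angle k = pi / 2"
  by (simp_all add: fat_angle_def)

text \<open>A chord of length at least \<open>\<tau>\<close> would enter the normals' angle, which
  is exactly \<open>\<delta>\<close>, into the infimum and push it below
  \<open>\<phi>\<close>.\<close>

lemma close_support_points:
  assumes "min_oscillation K \<tau> \<ge> ereal \<phi>" "\<bar>s\<bar> = 1" "0 \<le> \<delta>" "\<delta> < \<phi>" "\<delta> \<le> pi"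
    and "p \<in> frontier K" "q \<in> frontier K"
    and "unit_normal \<theta> \<in> outer_normals K p" "unit_normal (\<theta> + s * \<delta>) \<in> outer_normals K q"
  shows "dist p q < \<tau>"
proof (rule ccontr)
  assume "\<not> dist p q < \<tau>"
  then have "min_oscillation K \<tau> \<le> ereal (arccos (unit_normal \<theta> \<bullet> unit_normal (\<theta> + s * \<delta>)))"
    unfolding min_oscillation_def using assms(6-9) by (intro Inf_lower) force
  moreover have "cos (s * \<delta>) = cos \<delta>"
    using assms(2) by (auto simp: abs_if split: if_splits)
  ultimately have "min_oscillation K \<tau> \<le> ereal \<delta>"
    using assms(3,5) by (simp add: inner_unit_normal arccos_cos)
  with assms(1) have "ereal \<phi> \<le> ereal \<delta>"
    by (rule order.trans)
  with assms(4) show False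
    by simp
qed

text \<open>Only steps strictly smaller than \<open>\<phi>\<close> force chords shorter than \<open>\<tau>\<close>, so the step
  \<open>fat_angle k\<close> is approached from below.\<close>

lemma support_bound:
  assumes "compact K" "x \<in> frontier K" "unit_normal \<alpha> \<in> outer_normals K x"
    and "min_oscillation K \<tau> \<ge> ereal \<phi>" "0 < \<tau>" and s: "\<bar>s\<bar> = 1"
    and k: "k \<ge> 1" "fat_angle k \<le> \<phi>" and m: "m \<le> 2 * k" and P: "P \<in> K"
  shows "(P - x) \<bullet> unit_normal (\<alpha> + s * (real m * fat_angle k))
    \<le> \<tau> * (\<Sum>r<m. chord_weight k (fat_angle k) r)"
proof (rule tendsto_le)
  let ?F = "at_left (fat_angle k)"
  show "?F \<noteq> bot"
    by simp
  show "((\<lambda>\<delta>. \<tau> * (\<Sum>r<m. chord_weight k \<delta> r)) \<longlongrightarrow>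
      \<tau> * (\<Sum>r<m. chord_weight k (fat_angle k) r)) ?F"
  proof (intro tendsto_intros)
    fix r
    \<comment> \<open>The branch depends only on \<open>r\<close> and \<open>k\<close>, so each
      weight is continuous in \<open>\<delta>\<close>.\<close>
    show "((\<lambda>\<delta>. chord_weight k \<delta> r) \<longlongrightarrow> chord_weight k (fat_angle k) r) ?F"
      unfolding chord_weight_def
      by (cases r k rule: linorder_cases) (auto intro!: tendsto_intros)
  qed
  show "((\<lambda>\<delta>. (P - x) \<bullet> unit_normal (\<alpha> + s * (real m * \<delta>))) \<longlongrightarrow>
      (P - x) \<bullet> unit_normal (\<alpha> + s * (real m * fat_angle k))) ?F"
    unfolding unit_normal_def by (intro tendsto_intros)
  \<comment> \<open>Chosen so that \<open>real (Suc k) * d\<close> is a right angle, the least step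
    that the chain bound admits.\<close>
  define d where "d = real k * fat_angle k / real (Suc k)"
  have d: "0 \<le> d" "d < fat_angle k"
    using fat_angle_pos[OF k(1)] by (auto simp: d_def field_simps)
  have "(P - x) \<bullet> unit_normal (\<alpha> + s * (real m * \<delta>)) \<le> \<tau> * (\<Sum>r<m. chord_weight k \<delta> r)"
    if \<delta>: "d < \<delta>" "\<delta> < fat_angle k" for \<delta>
  proof (rule support_chain_bound[OF assms(1-3) s _ _ _ m _ _ P])
    have "real k * \<delta> \<le> real k * fat_angle k"
      using \<delta> by (intro mult_left_mono) auto
    then show "real k * \<delta> \<le> pi / 2"
      using mult_fat_angle[OF k(1)] by simp
    have "real (Suc k) * d \<le> real (Suc k) * \<delta>"
      using \<delta> by (intro mult_left_mono) auto
    then show "pi / 2 \<le> real (Suc k) * \<delta>"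
      using mult_fat_angle[OF k(1)] by (simp add: d_def del: of_nat_Suc)
    have "fat_angle k \<le> pi"
      using k(1) by (simp add: fat_angle_def field_simps)
    then show "dist p q \<le> \<tau>" if "p \<in> frontier K" "q \<in> frontier K"
      "unit_normal \<theta> \<in> outer_normals K p" "unit_normal (\<theta> + s * \<delta>) \<in> outer_normals K q" for p q \<theta>
      using close_support_points[OF assms(4) s _ _ _ that] d(1) \<delta> k(2) by simp
  qed (use d \<delta> \<open>0 < \<tau>\<close> in auto)
  then show "\<forall>\<^sub>F \<delta> in ?F. (P - x) \<bullet> unit_normal (\<alpha> + s * (real m * \<delta>)) \<le>
      \<tau> * (\<Sum>r<m. chord_weight k \<delta> r)"
    using eventually_at_left_real[OF d(2)] by (auto elim: eventually_mono)
qed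

subsection \<open>Vertices and supporting lines of the fattened polygon\<close>

text \<open>The second sum in \<open>fat_vertex\<close> gains a term exactly at multiples of
  \<open>k\<close>, parallel to the edge just added. Index 0 also gets length 2, in agreement with
  edge \<open>4 * k\<close>.\<close>

definition edge_length :: "nat \<Rightarrow> nat \<Rightarrow> real" where
  "edge_length k j = (if k dvd j then 2 else 1)"

lemma fat_vertex_eq:
  "fat_vertex k m = (\<Sum>j=1..m. cis (real j * fat_angle k)) +
     (\<Sum>l=0..m div k. cis (real l * real k * fat_angle k))"
  by (simp add: fat_vertex_def complex_eq_iff)

lemma fat_vertex_0: "fat_vertex k 0 = 1"
  by (simp add: fat_vertex_eq)

lemma fat_vertex_Suc:
  assumes "k \<ge> 1"
  shows "fat_vertex k (Suc m) =
    fat_vertex k m + edge_length k (Suc m) *\<^sub>R cis (real (Suc m) * fat_angle k)"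
proof (cases "k dvd Suc m")
  case True
  then have "real (Suc (m div k)) * real k = real (Suc m)"
    by (metis div_Suc dvd_div_mult_self dvd_imp_mod_0 of_nat_mult)
  with True show ?thesis
    by (simp add: fat_vertex_eq edge_length_def div_Suc dvd_imp_mod_0 scaleR_2 del: of_nat_Suc)
next
  case False
  then show ?thesis
    by (simp add: fat_vertex_eq edge_length_def div_Suc dvd_eq_mod_eq_0 del: of_nat_Suc)
qed

lemma fat_vertex_inner_Suc:
  assumes "k \<ge> 1"
  shows "fat_vertex k m \<bullet> unit_normal (real (Suc m) * fat_angle k) =
    fat_vertex k (Suc m) \<bullet> unit_normal (real (Suc m) * fat_angle k)"
  by (simp add: fat_vertex_Suc[OF assms] inner_add_left inner_cis_unit_normal del: of_nat_Suc)

lemma cis_half_turn: "k \<ge> 1 \<Longrightarrow> cis (real (j + 2 * k) * fat_angle k) = - cis (real j * fat_angle k)"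
  by (simp add: complex_eq_iff distrib_right mult.assoc mult_fat_angle)

text \<open>The first sum cancels in antipodal pairs and the second runs through five quarter turns.
  With \<open>fat_vertex_0\<close> this closes the polygon, so index 0 is another name for vertex
  \<open>4 * k\<close>.\<close>

lemma fat_vertex_last:
  assumes "k \<ge> 1"
  shows "fat_vertex k (4 * k) = 1"
proof -
  have "(\<Sum>j=1..4*k. cis (real j * fat_angle k)) =
      (\<Sum>j=1..2*k. cis (real j * fat_angle k)) + (\<Sum>j=1..2*k. cis (real (j + 2*k) * fat_angle k))"
    using sum.ub_add_nat[of 1 "2*k" "\<lambda>j. cis (real j * fat_angle k)" "2*k"]
      sum.shift_bounds_cl_nat_ivl[of "\<lambda>j. cis (real j * fat_angle k)" 1 "2*k" "2*k"]
    by simp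
  also have "\<dots> = 0"
    using assms by (simp only: cis_half_turn sum_negf) simp
  finally have 1: "(\<Sum>j=1..4*k. cis (real j * fat_angle k)) = 0" .
  have "(\<Sum>l=0..4. cis (real l * real k * fat_angle k)) = (\<Sum>l\<le>4. cis (real l * (pi / 2)))"
    by (simp add: mult.assoc mult_fat_angle[OF assms] atMost_atLeast0)
  also have "\<dots> = 1"
  proof -
    have "cis (3 * (pi / 2)) = - \<i>"
      using cis_mult[of pi "pi / 2"] by simp
    then show ?thesis
      by (simp add: numeral_eq_Suc)
  qed
  finally show ?thesis
    using 1 assms by (simp add: fat_vertex_eq)
qed

text \<open>Reflection in the imaginary axis swaps the vertices \<open>m\<close> and \<open>4 * k - 1 - m\<close>; the last summand is
  the edge from there to vertex \<open>4 * k - m\<close>.\<close>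

lemma fat_vertex_reflect:
  assumes "k \<ge> 1" "m \<le> 4 * k"
  shows "fat_vertex k (4 * k - m) =
    - cnj (fat_vertex k m) + edge_length k m *\<^sub>R cis (- (real m * fat_angle k))"
  using assms(2)
proof (induction m)
  case 0
  then show ?case
    using fat_vertex_last[OF assms(1)] by (simp add: fat_vertex_0 edge_length_def complex_eq_iff)
next
  case (Suc m)
  let ?n = "4 * k - Suc m"
  have n: "Suc ?n = 4 * k - m"
    using Suc.prems by simp
  have "real (4 * k - m) * fat_angle k = 2 * pi - real m * fat_angle k"
    using Suc.prems mult_fat_angle[OF assms(1)] by (simp add: of_nat_diff algebra_simps)
  then have "cis (real (4 * k - m) * fat_angle k) = cis (- (real m * fat_angle k))"
    by (simp add: complex_eq_iff)
  moreover have "edge_length k (4 * k - m) = edge_length k m"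
  proof -
    have "k dvd 4 * k - m \<longleftrightarrow> k dvd m"
      using Suc.prems dvd_diffD1[of k "4 * k" m] dvd_diff_nat[of k "4 * k" m]
      by (meson dvd_triv_right Suc_leD)
    then show ?thesis
      by (simp add: edge_length_def)
  qed
  \<comment> \<open>Stepping back along the edge into vertex \<open>4 * k - m\<close> removes the
    extra summand of the induction hypothesis.\<close>
  ultimately have "fat_vertex k ?n = fat_vertex k (4 * k - m) -
      edge_length k m *\<^sub>R cis (- (real m * fat_angle k))"
    using fat_vertex_Suc[OF assms(1), of ?n] unfolding n by simp
  also have "\<dots> = - cnj (fat_vertex k m)"
    using Suc by simp
  finally show ?case
    using fat_vertex_Suc[OF assms(1), of m] by (simp add: cis_cnj del: of_nat_Suc)
qed

section \<open>Support values of the polygon\<close>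

text \<open>The extra edge in \<open>fat_vertex_reflect\<close> is orthogonal to this normal, and
  reflection is an isometry. This serves the clockwise walk.\<close>

lemma fat_support_reflect:
  assumes "k \<ge> 1" "m \<le> 4 * k"
  shows "fat_vertex k (4 * k - m) \<bullet> unit_normal (- (real m * fat_angle k)) =
    fat_vertex k m \<bullet> unit_normal (real m * fat_angle k)"
  by (simp only: fat_vertex_reflect[OF assms] inner_add_left inner_scaleR_left
      inner_cis_unit_normal, simp only: unit_normal_minus inner_neg_cnj) simp

text \<open>At this step the weight 1 for \<open>r = k\<close> equals
  \<open>sin (real r * \<delta>)\<close>, so only the shift by one in the terms \<open>r < k\<close>
  remains, and it telescopes.\<close>

lemma sum_chord_weight:
  assumes "k \<ge> 1"
  shows "(\<Sum>r<m. chord_weight k (fat_angle k) r) =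
    (\<Sum>r<m. sin (real r * fat_angle k)) + sin (real (min m k) * fat_angle k)"
proof (induction m)
  case (Suc m)
  have "sin (real k * fat_angle k) = 1"
    by (simp add: mult_fat_angle[OF assms])
  with Suc show ?case
    by (cases m k rule: linorder_cases) (auto simp: chord_weight_def min_def simp del: of_nat_Suc)
qed auto

text \<open>The first sum of the vertex reproduces the sine sum in \<open>sum_chord_weight\<close>;
  the second, coming from the doubled edges, dominates the remaining sine.\<close>

lemma fat_support_ge:
  assumes "k \<ge> 1" "m \<le> 2 * k"
  shows "(\<Sum>r<m. chord_weight k (fat_angle k) r) \<le>
    fat_vertex k m \<bullet> unit_normal (real m * fat_angle k)"
proof -
  let ?f = "fat_angle k"
  define R where "R = (\<Sum>l=0..m div k. sin (real m * ?f - real l * real k * ?f))"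
  have "(\<Sum>j=1..m. sin (real m * ?f - real j * ?f)) = (\<Sum>j<m. sin (real m * ?f - real (Suc j) * ?f))"
    by (simp add: sum.atLeast1_atMost_eq del: of_nat_Suc)
  also have "\<dots> = (\<Sum>j<m. sin (real (m - Suc j) * ?f))"
    by (intro sum.cong) (auto simp: of_nat_diff left_diff_distrib)
  also have "\<dots> = (\<Sum>r<m. sin (real r * ?f))"
    by (rule sum.nat_diff_reindex)
  finally have "fat_vertex k m \<bullet> unit_normal (real m * ?f) = (\<Sum>r<m. sin (real r * ?f)) + R"
    by (simp add: fat_vertex_eq inner_add_left inner_sum_left inner_cis_unit_normal R_def)
  moreover have "sin (real (min m k) * ?f) \<le> R"
  proof -
    consider "m < k" | "k \<le> m" "m < 2 * k" | "m = 2 * k"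
      using assms(2) by linarith
    then show ?thesis
    proof cases
      case 1
      then show ?thesis
        by (simp add: R_def)
    next
      case 2
      define \<beta> where "\<beta> = real m * ?f"
      have "m div k = 1"
        using 2 by (intro div_nat_eqI) auto
      then have R: "R = sin \<beta> - cos \<beta>"
        by (simp add: R_def \<beta>_def mult_fat_angle[OF assms(1)] sin_diff)
      have "real k * ?f \<le> \<beta>" "\<beta> \<le> real (2 * k) * ?f"
        unfolding \<beta>_def using 2 fat_angle_pos[OF assms(1)] by (auto intro!: mult_right_mono)
      then have \<beta>: "pi / 2 \<le> \<beta>" "\<beta> \<le> pi"
        using mult_fat_angle[OF assms(1)] by simp_all
      then have "0 \<le> sin \<beta>" "0 \<le> - cos \<beta>"
        using cos_ge_zero[of "pi - \<beta>"] by (auto intro!: sin_ge_zero)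
      \<comment> \<open>Both \<open>sin \<beta>\<close> and \<open>- cos \<beta>\<close> lie between
        0 and 1, so they dominate their squares, which sum to 1.\<close>
      then have "sin \<beta> * sin \<beta> \<le> sin \<beta> * 1" "(- cos \<beta>) * (- cos \<beta>) \<le> (- cos \<beta>) * 1"
        using cos_ge_minus_one[of \<beta>] by (intro mult_left_mono; simp)+
      then have "1 \<le> sin \<beta> - cos \<beta>"
        using sin_cos_squared_add[of \<beta>] by (simp add: power2_eq_square)
      with 2 R show ?thesis
        by (simp add: mult_fat_angle[OF assms(1)])
    next
      case 3
      have "m div k = 2"
        using 3 assms(1) by simp
      with 3 show ?thesis
        by (simp add: R_def numeral_2_eq_2 mult.assoc mult_fat_angle[OF assms(1)])
    qed
  qed
  ultimately show ?thesis
    by (simp add: sum_chord_weight[OF assms(1)])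
qed

text \<open>A separating direction is a nonnegative combination of two consecutive edge normals, and
  both of these are maximised on the polygon at the vertex between the two edges.\<close>

lemma std_fat_ngonI:
  assumes k: "k \<ge> 1"
    and z: "\<And>m. m \<le> 4 * k \<Longrightarrow> z \<bullet> unit_normal (real m * fat_angle k) \<le>
      fat_vertex k m \<bullet> unit_normal (real m * fat_angle k)"
  shows "z \<in> std_fat_ngon k"
proof (rule ccontr)
  let ?f = "fat_angle k"
  have f: "0 < ?f" "?f \<le> pi / 2"
    using k by (simp_all add: fat_angle_def field_simps)
  assume "z \<notin> std_fat_ngon k"
  moreover have "closed (std_fat_ngon k)" "convex (std_fat_ngon k)"
    unfolding std_fat_ngon_def
    by (auto intro!: compact_imp_closed finite_imp_compact_convex_hull)
  ultimately obtain a b where ab: "a \<bullet> z < b" "\<forall>y\<in>std_fat_ngon k. b < a \<bullet> y"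
    using separating_hyperplane_closed_point[of "std_fat_ngon k" z] by metis
  have vertex: "fat_vertex k m \<in> std_fat_ngon k" if "m \<le> 4 * k" for m
  proof (cases "m = 0")
    case True
    then have "fat_vertex k m = fat_vertex k (4 * k)"
      using fat_vertex_last[OF k] fat_vertex_0 by simp
    then show ?thesis
      using k unfolding std_fat_ngon_def by (auto intro!: hull_inc)
  next
    case False
    with that show ?thesis
      unfolding std_fat_ngon_def by (auto intro!: hull_inc)
  qed
  from ab vertex[of 0] have "a \<noteq> 0"
    by force
  \<comment> \<open>The sign is flipped because \<open>a\<close> is smaller at \<open>z\<close> than
    on the polygon.\<close>
  then have "norm ((-1 / norm a) *\<^sub>R a) = 1"
    by simp
  then obtain \<theta> where \<theta>: "0 \<le> \<theta>" "\<theta> < 2 * pi" "(-1 / norm a) *\<^sub>R a = unit_normal \<theta>"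
    by (rule unit_vector_unit_normal)
  have sep: "y \<bullet> unit_normal \<theta> < z \<bullet> unit_normal \<theta>" if "y \<in> std_fat_ngon k" for y
  proof -
    have "a \<bullet> z < a \<bullet> y"
      using ab that by force
    with \<open>a \<noteq> 0\<close> show ?thesis
      by (simp flip: \<theta>(3) add: inner_commute divide_strict_right_mono)
  qed
  \<comment> \<open>The sector between consecutive edge normals that contains
    \<open>\<theta>\<close>.\<close>
  define m where "m = nat \<lfloor>\<theta> / ?f\<rfloor>"
  have "real m = of_int \<lfloor>\<theta> / ?f\<rfloor>"
    using \<theta>(1) f by (simp add: m_def)
  then have "real m \<le> \<theta> / ?f" "\<theta> / ?f < real m + 1"
    by linarith+
  then have m: "real m * ?f \<le> \<theta>" "\<theta> < real (Suc m) * ?f"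
    using f by (simp_all add: field_simps)
  have "real m * ?f < real (4 * k) * ?f"
    using m(1) \<theta>(2) mult_fat_angle[OF k] by simp
  then have m4: "m < 4 * k"
    using f by (simp only: mult_less_cancel_right_pos of_nat_less_iff)
  define b c where "b = sin (real (Suc m) * ?f - \<theta>)" and "c = sin (\<theta> - real m * ?f)"
  have "0 \<le> b" "0 \<le> c"
    unfolding b_def c_def using m f by (auto intro!: sin_ge_zero simp: distrib_right)
  have sin_f: "0 < sin ?f"
    using f by (intro sin_gt_zero) auto
  have comb: "sin ?f *\<^sub>R unit_normal \<theta> =
      b *\<^sub>R unit_normal (real m * ?f) + c *\<^sub>R unit_normal (real (Suc m) * ?f)"
  proof -
    define u v where "u = \<theta> - real m * ?f" and "v = real m * ?f"
    have e: "\<theta> = v + u" "real (Suc m) * ?f = v + ?f"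
      by (simp_all add: u_def v_def algebra_simps)
    have v: "real m * ?f = v" by (simp add: v_def)
    have bc: "b = sin (?f - u)" "c = sin u"
      by (simp_all add: b_def c_def u_def algebra_simps)
    show ?thesis
      unfolding e v bc unit_normal_add by (simp add: sin_diff algebra_simps)
  qed
  have "sin ?f * (z \<bullet> unit_normal \<theta>) =
      b * (z \<bullet> unit_normal (real m * ?f)) + c * (z \<bullet> unit_normal (real (Suc m) * ?f))"
    by (simp only: comb inner_add_right flip: inner_scaleR_right)
  also have "\<dots> \<le> b * (fat_vertex k m \<bullet> unit_normal (real m * ?f)) +
      c * (fat_vertex k (Suc m) \<bullet> unit_normal (real (Suc m) * ?f))"
    using \<open>0 \<le> b\<close> \<open>0 \<le> c\<close> m4 by (intro add_mono mult_left_mono z) auto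
  also have "\<dots> = sin ?f * (fat_vertex k m \<bullet> unit_normal \<theta>)"
    by (simp only: comb inner_add_right fat_vertex_inner_Suc[OF k, symmetric]
        flip: inner_scaleR_right)
  finally show False
    using sep[OF vertex[of m]] m4 sin_f by simp
qed

section \<open>Containment of the body in the polygon\<close>

theorem theorem5:
  fixes K :: "complex set" and \<tau> \<phi> \<alpha> :: real and x :: complex
  assumes "convex_body K"
    and "\<tau> > 0"
    and "0 < \<phi>" and "\<phi> < pi"
    and "min_oscillation K \<tau> \<ge> ereal \<phi>"
    and "x \<in> frontier K"
    and "Complex (sin \<alpha>) (- cos \<alpha>) \<in> outer_normals K x"
  shows "K \<subseteq> fat_ngon x \<alpha> \<phi> \<tau>"
proof
  fix P
  assume P: "P \<in> K"
  define k where "k = nat \<lceil>pi / (2 * \<phi>)\<rceil>"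
  have "0 < pi / (2 * \<phi>)"
    using assms(3) by simp
  then have k: "k \<ge> 1" "pi / (2 * \<phi>) \<le> real k"
    unfolding k_def by linarith+
  then have "fat_angle k \<le> \<phi>"
    using assms(3) by (simp add: fat_angle_def field_simps)
  \<comment> \<open>The preimage of \<open>P\<close> under the similarity defining
    \<open>fat_ngon\<close>.\<close>
  define z where "z = cis (- \<alpha>) * ((1 / \<tau>) *\<^sub>R (P - x))"
  have Pz: "P = cis \<alpha> * (\<tau> *\<^sub>R z) + x"
    using assms(2) by (simp add: z_def cis_mult flip: mult.assoc)
  have bound: "z \<bullet> unit_normal (s * (real m * fat_angle k)) \<le>
      fat_vertex k m \<bullet> unit_normal (real m * fat_angle k)" if "\<bar>s\<bar> = 1" "m \<le> 2 * k" for s m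
  proof -
    have "\<tau> * (z \<bullet> unit_normal (s * (real m * fat_angle k))) =
        (P - x) \<bullet> unit_normal (\<alpha> + s * (real m * fat_angle k))"
      using inner_rotate_unit_normal[of \<alpha> "\<tau> *\<^sub>R z" "s * (real m * fat_angle k)"]
      by (simp only: Pz add.commute[of \<alpha>] add_diff_cancel_right' inner_scaleR_left)
    also have "\<dots> \<le> \<tau> * (\<Sum>r<m. chord_weight k (fat_angle k) r)"
      using assms that P k \<open>fat_angle k \<le> \<phi>\<close>
      by (intro support_bound) (simp_all add: convex_body_def unit_normal_def)
    also have "\<dots> \<le> \<tau> * (fat_vertex k m \<bullet> unit_normal (real m * fat_angle k))"
      using fat_support_ge[OF k(1) that(2)] assms(2) by simp
    finally show ?thesis
      using assms(2) by simp
  qed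
  have "z \<in> std_fat_ngon k"
  proof (rule std_fat_ngonI[OF k(1)])
    fix m
    assume m: "m \<le> 4 * k"
    show "z \<bullet> unit_normal (real m * fat_angle k) \<le>
      fat_vertex k m \<bullet> unit_normal (real m * fat_angle k)"
    proof (cases "m \<le> 2 * k")
      case True
      then show ?thesis
        using bound[of 1 m] by simp
    next
      case False
      \<comment> \<open>Past a half turn, the same normal is reached by \<open>j\<close> clockwise
        steps.\<close>
      define j where "j = 4 * k - m"
      have j: "j \<le> 2 * k" "m = 4 * k - j"
        using False m by (auto simp: j_def)
      have "real m * fat_angle k = - (real j * fat_angle k) + 2 * pi"
        using j mult_fat_angle[OF k(1)] by (simp add: of_nat_diff algebra_simps)
      then have "unit_normal (real m * fat_angle k) = unit_normal (- (real j * fat_angle k))"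
        by (simp add: unit_normal_def)
      with bound[of "-1" j] fat_support_reflect[OF k(1), of j] j show ?thesis
        by simp
    qed
  qed
  with Pz show "P \<in> fat_ngon x \<alpha> \<phi> \<tau>"
    unfolding fat_ngon_def k_def by blast
qed

end
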